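(* Let $f$ be a meromorphic function in $\mathbb{D}=\{z\in\mathbb{C}: |z|<1\}$ such that $f(0)=f'(0)-1=0$. If $$\left|\frac{z}{f(z)}-z\left(\frac{z}{f(z)}\right)'-1\right|<1\quad\text{for all } z\in\mathbb{D},$$ then $f$ is univalent in $\mathbb{D}$.
   Context: Univalent means injective; a meromorphic function is regarded as a map into the Riemann sphere $\mathbb{C}\cup\{\infty\}$, so $f$ is allowed to have a pole in $\mathbb{D}$. The function $z/f(z)$ is understood as the meromorphic function on $\mathbb{D}$ obtained after removing removable singularities: it takes the value $1$ at $z=0$ and the value $0$ at poles of $f$. The prime denotes the derivative with respect to $z$. The hypothesis that the inequality holds for all $z\in\mathbb{D}$ includes that $z/f(z)$ is finite (holomorphic) at every point of $\mathbb{D}$. *)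

theory Defs
  imports "HOL-Complex_Analysis.Complex_Analysis"
begin

text \<open>
  The Riemann sphere is the type \<open>complex option\<close> with \<open>None\<close> as the point at infinity
  (the carrier of \<open>Alexandroff_compactification euclidean\<close>).  A nicely meromorphic function has
  the conventional value \<open>0\<close> at its poles; the corresponding sphere-valued map has the value
  infinity there.
\<close>

definition to_sphere :: "(complex \<Rightarrow> complex) \<Rightarrow> complex \<Rightarrow> complex option" where
  "to_sphere f z = (if is_pole f z then None else Some (f z))"

definition univalent_on :: "(complex \<Rightarrow> complex) \<Rightarrow> complex set \<Rightarrow> bool" where
  "univalent_on f A \<longleftrightarrow> inj_on (to_sphere f) A"

text \<open>
  The meromorphic function \<open>z / f z\<close> with its removable singularities removed.  For the functions
  \<open>f\<close> considered here it has the value \<open>1\<close> at \<open>0\<close> and the value \<open>0\<close> at the poles of \<open>f\<close>.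
  At a pole of \<open>z / f z\<close>, \<open>remove_sings\<close> yields the conventional value \<open>0\<close>, so
  finiteness of \<open>z / f z\<close> has to be required separately (as holomorphy of \<open>quot_id f\<close>).
\<close>

definition quot_id :: "(complex \<Rightarrow> complex) \<Rightarrow> complex \<Rightarrow> complex" where
  "quot_id f = remove_sings (\<lambda>z. z / f z)"

end

theory Submission
  imports Defs
begin

text \<open>
  Write \<open>g\<close> for the holomorphic function \<open>z / f z\<close>.  Since \<open>g 0 = 1\<close>, it has the form
  \<open>g z = 1 + z * p z\<close> with \<open>p\<close> holomorphic on the disc; away from \<open>0\<close> this says that
  \<open>1 / f z = 1 / z + p z\<close>, so \<open>1 / f\<close> is a perturbation of \<open>1 / z\<close> by \<open>p\<close>.  The expression in the hypothesis collapses to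
  \<open>g z - z * g' z - 1 = - z\<^sup>2 * p' z\<close>.  By the maximum principle (as in the Schwarz lemma) the
  bound \<open>\<bar>z\<^sup>2 * p' z\<bar> < 1\<close> improves to \<open>\<bar>p' z\<bar> \<le> 1\<close>, so \<open>p\<close> is a
  weak contraction on the convex disc.

  On the other hand \<open>f a = f b\<close> forces \<open>1 / a + p a = 1 / b + p b\<close>, that is
  \<open>b - a = a * b * (p b - p a)\<close>.  The right-hand side has modulus at most
  \<open>\<bar>a\<bar> * \<bar>b\<bar> * \<bar>b - a\<bar>\<close>, and \<open>\<bar>a\<bar> * \<bar>b\<bar> < 1\<close>, hence \<open>a = b\<close>.
  To treat poles of \<open>f\<close> and the origin together with all other points, the equality of values is
  used in the denominator-free form \<open>b * g a = a * g b\<close>.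
\<close>

section \<open>Bounded perturbations of the reciprocal\<close>

text \<open>
  The maximum principle on the disc of radius \<open>r\<close> bounds \<open>k\<close> by \<open>1 / r ^ n\<close>; then \<open>r\<close> tends
  to \<open>1\<close>.  For holomorphic functions with a zero of order \<open>n\<close> at the origin this is the
  Schwarz lemma of order \<open>n\<close>.
\<close>

lemma norm_le_1_if_power_mult_le_1:
  fixes k :: "complex \<Rightarrow> complex"
  assumes hol: "k holomorphic_on ball 0 1"
    and bound: "\<And>z. z \<in> ball 0 1 \<Longrightarrow> norm (z ^ n * k z) \<le> 1"
    and w: "w \<in> ball 0 1"
  shows "norm (k w) \<le> 1"
proof -
  have scaled: "r ^ n * norm (k w) \<le> 1" if r: "norm w < r" "r < 1" for r :: real
  proof -
    have r0: "r > 0"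
      using r norm_ge_zero[of w] by linarith
    have sub: "cball (0::complex) r \<subseteq> ball 0 1"
      using r by auto
    have "norm (k w) \<le> 1 / r ^ n"
    proof (rule maximum_modulus_frontier[where S = "cball 0 r" and f = k])
      show "k holomorphic_on interior (cball 0 r)"
        using hol sub interior_subset by (blast intro: holomorphic_on_subset)
      show "continuous_on (closure (cball 0 r)) k"
        using holomorphic_on_imp_continuous_on[OF hol] sub
        by (simp add: continuous_on_subset)
      show "bounded (cball (0::complex) r)"
        by simp
      show "w \<in> cball 0 r"
        using r by simp
    next
      fix z :: complex
      assume "z \<in> frontier (cball 0 r)"
      then have z: "norm z = r"
        using r0 by (simp add: frontier_cball)
      then have "norm (z ^ n * k z) \<le> 1"
        using r by (intro bound) simp
      then show "norm (k z) \<le> 1 / r ^ n"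
        using r0 z by (simp add: norm_mult norm_power field_simps)
    qed
    then show ?thesis
      using r0 by (simp add: field_simps)
  qed
  have "((\<lambda>r. r ^ n * norm (k w)) \<longlongrightarrow> 1 ^ n * norm (k w)) (at_left 1)"
    by (intro tendsto_intros)
  moreover have "eventually (\<lambda>r. r ^ n * norm (k w) \<le> 1) (at_left (1::real))"
    using eventually_at_left_real[of "norm w" 1] w
    by (auto elim!: eventually_mono intro: scaled)
  ultimately have "1 ^ n * norm (k w) \<le> 1"
    by (intro tendsto_upperbound) auto
  then show ?thesis
    by simp
qed

text \<open>
  For nonzero \<open>a\<close> and \<open>b\<close> the hypothesis says that \<open>1 / z + p z\<close> takes the same value at
  both points.  A weak contraction \<open>p\<close> cannot compensate the difference of the reciprocals,
  because \<open>1 / z\<close> strictly expands distances inside the unit disc.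
\<close>

lemma reciprocal_plus_contraction_inj:
  fixes p :: "complex \<Rightarrow> complex"
  assumes lip: "norm (p b - p a) \<le> norm (b - a)"
    and "norm a < 1" "norm b < 1"
    and eq: "b * (1 + a * p a) = a * (1 + b * p b)"
  shows "a = b"
proof (rule ccontr)
  assume "a \<noteq> b"
  have "b - a = a * b * (p b - p a)"
    using eq by (simp add: algebra_simps)
  then have "norm (b - a) = norm a * norm b * norm (p b - p a)"
    by (metis norm_mult)
  also have "\<dots> \<le> norm a * norm b * norm (b - a)"
    using lip by (intro mult_left_mono) auto
  also have "\<dots> < 1 * norm (b - a)"
  proof (rule mult_strict_right_mono)
    have "norm a * norm b \<le> norm a"
      using assms by (intro mult_left_le) auto
    then show "norm a * norm b < 1"
      using assms by linarith
  qed (use \<open>a \<noteq> b\<close> in simp)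
  finally show False
    by simp
qed

text \<open>
  The condition on \<open>g\<close> is the one imposed on \<open>z / f z\<close>; the conclusion is the injectivity of the
  sphere-valued map \<open>z / g z\<close>, stated without denominators.
\<close>

lemma holomorphic_quotient_inj:
  fixes g :: "complex \<Rightarrow> complex"
  assumes hol: "g holomorphic_on ball 0 1" and g0: "g 0 = 1"
    and bound: "\<And>z. z \<in> ball 0 1 \<Longrightarrow> norm (g z - z * deriv g z - 1) < 1"
    and a: "a \<in> ball 0 1" and b: "b \<in> ball 0 1"
    and eq: "b * g a = a * g b"
  shows "a = b"
proof -
  have "(\<lambda>z. g z - 1) holomorphic_on ball 0 1"
    by (intro holomorphic_intros hol)
  then obtain p where p: "p holomorphic_on ball 0 1"
    and gp: "\<And>z. norm z < 1 \<Longrightarrow> g z - 1 = z * p z"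
    using Schwarz3[of "\<lambda>z. g z - 1" 1] g0 by auto
  have g_eq: "g z = 1 + z * p z" if "z \<in> ball 0 1" for z
    using gp[of z] that by (simp add: algebra_simps)
  have dp: "(p has_field_derivative deriv p z) (at z)" if "z \<in> ball 0 1" for z
    using p that by (intro holomorphic_derivI[of p "ball 0 1"]) auto
  have collapse: "g z - z * deriv g z - 1 = - (z ^ 2 * deriv p z)" if z: "z \<in> ball 0 1" for z
  proof -
    have "((\<lambda>z. 1 + z * p z) has_field_derivative p z + z * deriv p z) (at z)"
      by (auto intro!: derivative_eq_intros dp z)
    then have "(g has_field_derivative p z + z * deriv p z) (at z)"
      by (rule has_field_derivative_transform_within_open[of _ _ _ "ball 0 1"]) (use z in \<open>auto simp: g_eq\<close>)
    then show ?thesis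
      using g_eq[OF z] by (simp add: DERIV_imp_deriv power2_eq_square algebra_simps)
  qed
  have "norm (deriv p z) \<le> 1" if "z \<in> ball 0 1" for z
  proof (rule norm_le_1_if_power_mult_le_1[where n = 2 and k = "deriv p"])
    show "deriv p holomorphic_on ball 0 1"
      by (intro holomorphic_deriv p open_ball)
    show "norm (z ^ 2 * deriv p z) \<le> 1" if "z \<in> ball 0 1" for z
      using bound[OF that] collapse[OF that] by simp
  qed fact
  then have "norm (p b - p a) \<le> 1 * norm (b - a)"
    using a b dp
    by (intro field_differentiable_bound[of "ball 0 1" p "deriv p"])
       (auto intro: has_field_derivative_at_within)
  moreover have "b * (1 + a * p a) = a * (1 + b * p b)"
    using eq g_eq[OF a] g_eq[OF b] by simp
  ultimately show ?thesis
    using a b by (intro reciprocal_plus_contraction_inj[of p b a]) auto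
qed

section \<open>The relation between a function and its regularised quotient\<close>

lemma quot_id_at_0:
  assumes "f 0 = 0" and "(f has_field_derivative 1) (at 0)"
  shows "quot_id f 0 = 1"
proof -
  have "((\<lambda>z. f z / z) \<longlongrightarrow> 1) (at 0)"
    using assms by (simp add: has_field_derivative_iff)
  then have "((\<lambda>z. inverse (f z / z)) \<longlongrightarrow> inverse 1) (at 0)"
    by (intro tendsto_inverse) auto
  then show ?thesis
    unfolding quot_id_def by (intro remove_sings_eqI) simp
qed

text \<open>
  The zeros of \<open>f\<close>, which does not vanish identically on the connected set \<open>A\<close>, are
  isolated, and \<open>remove_sings\<close> alters only isolated values.
\<close>

lemma eventually_quot_id_mult:
  assumes mero: "f nicely_meromorphic_on A" and A: "open A" "connected A"
    and nz: "u \<in> A" "f u \<noteq> 0" and z: "z \<in> A"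
  shows "eventually (\<lambda>w. f w \<noteq> 0 \<and> quot_id f w * f w = w) (at z)"
proof -
  have "\<not> frequently (\<lambda>w. f w = 0) (at z)"
    using frequently_eq_meromorphic_imp_constant[OF _ mero A z nz(1)] nz(2) by blast
  then have "eventually (\<lambda>w. f w \<noteq> 0) (at z)"
    by (simp add: not_frequently)
  moreover have "f meromorphic_on {z}"
    using mero z unfolding nicely_meromorphic_on_def by (auto intro: meromorphic_on_subset)
  then have "(\<lambda>w. w / f w) meromorphic_on {z}"
    by (intro meromorphic_intros)
  then have "isolated_singularity_at (\<lambda>w. w / f w) z"
    by (simp add: meromorphic_on_isolated_singularity)
  then have "eventually (\<lambda>w. quot_id f w = w / f w) (at z)"
    unfolding quot_id_def by (rule eventually_remove_sings_eq_at)
  ultimately show ?thesis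
    by eventually_elim simp
qed

text \<open>
  Let \<open>w\<close> tend to \<open>z\<close> in \<open>quot_id f w * f w = w\<close>.  The result excludes zeros of
  \<open>f\<close> away from the origin: at such a zero \<open>w / f w\<close> would have a pole, whereas
  \<open>quot_id f\<close> is continuous.
\<close>

lemma quot_id_mult_if_not_pole:
  assumes mero: "f nicely_meromorphic_on A" and z: "z \<in> A" "\<not> is_pole f z"
    and cont: "isCont (quot_id f) z"
    and ev: "eventually (\<lambda>w. f w \<noteq> 0 \<and> quot_id f w * f w = w) (at z)"
  shows "quot_id f z * f z = z"
proof -
  have "f \<midarrow>z\<rightarrow> f z"
    using mero z by (auto simp: nicely_meromorphic_on_def)
  then have "((\<lambda>w. quot_id f w * f w) \<longlongrightarrow> quot_id f z * f z) (at z)"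
    using cont by (intro tendsto_mult) (auto simp: isCont_def)
  then have "((\<lambda>w. w) \<longlongrightarrow> quot_id f z * f z) (at z)"
    by (rule Lim_transform_eventually) (use ev in \<open>auto elim: eventually_mono\<close>)
  then show ?thesis
    using tendsto_unique[OF _ _ tendsto_ident_at[of z UNIV]] by auto
qed

lemma quot_id_eq_0_if_pole:
  assumes pole: "is_pole f z"
    and cont: "isCont (quot_id f) z"
    and ev: "eventually (\<lambda>w. f w \<noteq> 0 \<and> quot_id f w * f w = w) (at z)"
  shows "quot_id f z = 0"
proof -
  have "((\<lambda>w. w * inverse (f w)) \<longlongrightarrow> z * 0) (at z)"
    using pole unfolding is_pole_def
    by (intro tendsto_mult tendsto_ident_at filterlim_compose[OF tendsto_inverse_0])
  moreover have "eventually (\<lambda>w. w * inverse (f w) = quot_id f w) (at z)"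
    using ev by eventually_elim (simp add: field_simps)
  ultimately have "(quot_id f \<longlongrightarrow> 0) (at z)"
    using Lim_transform_eventually by fastforce
  then show ?thesis
    using cont tendsto_unique[of "at z" "quot_id f"] by (auto simp: isCont_def)
qed

section \<open>Univalence\<close>

theorem theorem1:
  fixes f :: "complex \<Rightarrow> complex"
  assumes "f nicely_meromorphic_on ball 0 1"
    and "f 0 = 0"
    and "(f has_field_derivative 1) (at 0)"
    and "quot_id f holomorphic_on ball 0 1"
    and "\<And>z. z \<in> ball 0 1 \<Longrightarrow> norm (quot_id f z - z * deriv (quot_id f) z - 1) < 1"
  shows "univalent_on f (ball 0 1)"
proof -
  \<comment> \<open>Were \<open>f\<close> zero on the disc, its derivative at the origin would be \<open>0\<close>.\<close>
  have "\<exists>u\<in>ball 0 1. f u \<noteq> 0"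
  proof (rule ccontr)
    assume "\<not> (\<exists>u\<in>ball 0 1. f u \<noteq> 0)"
    then have "((\<lambda>_. 0) has_field_derivative 1) (at (0::complex))"
      by (intro has_field_derivative_transform_within_open[OF assms(3), of "ball 0 1"]) auto
    then show False
      using DERIV_unique[OF DERIV_const] by fastforce
  qed
  then obtain u where u: "u \<in> ball 0 1" "f u \<noteq> 0"
    by blast
  note ev = eventually_quot_id_mult[OF assms(1) open_ball connected_ball u]
  have cont: "isCont (quot_id f) z" if "z \<in> ball 0 1" for z
    using holomorphic_on_imp_continuous_on[OF assms(4)] that
    by (simp add: continuous_on_eq_continuous_at)
  have finite: "quot_id f z * f z = z" if "z \<in> ball 0 1" "\<not> is_pole f z" for z
    using quot_id_mult_if_not_pole[OF assms(1) that cont ev] that by blast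
  have pole: "quot_id f z = 0" if "z \<in> ball 0 1" "is_pole f z" for z
    using quot_id_eq_0_if_pole[OF that(2) cont ev] that by blast
  show ?thesis
    unfolding univalent_on_def
  proof (rule inj_onI)
    fix a b :: complex
    assume ab: "a \<in> ball 0 1" "b \<in> ball 0 1" and eq: "to_sphere f a = to_sphere f b"
    have "b * quot_id f a = a * quot_id f b"
    proof (cases "is_pole f a")
      case True
      then have "is_pole f b"
        using eq by (simp add: to_sphere_def split: if_splits)
      then show ?thesis
        using pole True ab by simp
    next
      case False
      then have "\<not> is_pole f b" and fab: "f a = f b"
        using eq by (simp_all add: to_sphere_def split: if_splits)
      then have "quot_id f a * f a = a" "quot_id f b * f a = b"
        using finite[of a] finite[of b] False ab by simp_all
      then show ?thesis
        by (metis mult.assoc mult.commute)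
    qed
    then show "a = b"
      using holomorphic_quotient_inj[OF assms(4) quot_id_at_0 assms(5)] assms(2,3) ab by blast
  qed
qed

end
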